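(* Let $L$ be the $0$-$1$ loss and $N\in\mathbb{N}$. Let $\mathcal{T}=\{T_i\}_{i=1}^N$ be a sequence of invertible column-stochastic $C\times C$ matrices, let $\ell:\Delta^C\times\mathcal{Y}\to\mathbb{R}$ be a continuous strictly proper loss, and let $w=(w_i)_{i=1}^N\in\Delta^N$. For a probability measure $P$ on $\mathcal{X}\times\mathcal{Y}$ define $\widetilde{\mathcal{R}}_{\ell,P,\mathcal{T}}:\mathcal{F}\to\mathbb{R}$ by $$\widetilde{\mathcal{R}}_{\ell,P,\mathcal{T}}(f)=\sum_{i=1}^N w_i\,\mathcal{R}_{\ell_{T_i},P_{T_i}}(f),\qquad \widetilde{\mathcal{R}}^*_{\ell,P,\mathcal{T}}=\inf_{f\in\mathcal{F}}\widetilde{\mathcal{R}}_{\ell,P,\mathcal{T}}(f).$$ Then there exists a strictly increasing continuous function $\theta:[0,1]\to[0,\infty]$ with $\theta(0)=0$ such that for all $P$ satisfying $\mathcal{R}^*_{\ell_{T_i},P_{T_i}}<\infty$ for every $i\in\{1,\dots,N\}$, and for all $f\in\mathcal{F}$, $$\theta\left(\mathcal{R}_{L,P}(f)-\mathcal{R}^*_{L,P}\right)\le\widetilde{\mathcal{R}}_{\ell,P,\mathcal{T}}(f)-\widetilde{\mathcal{R}}^*_{\ell,P,\mathcal{T}}.$$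
   Context: $\mathcal{X}$ is a (measurable) feature space, $\mathcal{Y}=\{1,\dots,C\}$, $\Delta^n=\{p\in\mathbb{R}^n: p_i\ge 0\ \forall i,\ \sum_i p_i=1\}$. $\mathcal{F}$ is the set of all measurable functions $\mathcal{X}\to\Delta^C$. For a probability measure $P$ on $\mathcal{X}\times\mathcal{Y}$ (law of $(X,Y)$), a regular conditional distribution $P(\cdot\mid x)$ of $Y$ given $X=x$ is assumed to exist and is fixed; $\eta(x)=(P(1\mid x),\dots,P(C\mid x))^{tr}\in\Delta^C$. Noisy distribution: for a column-stochastic $T=(t_{i,j})$, $P_T$ is the law of $(X,\tilde Y)$ on $\mathcal{X}\times\mathcal{Y}$, where $(X,Y,\tilde Y)$ has law $\bar P_T$ with $\bar P_T(\mathcal{A}\times\{i\}\times\{j\})=P(\mathcal{A}\times\{i\})\,t_{j,i}$; the conditional distribution of $\tilde Y$ given $X=x$ under $P_T$ is $T\eta(x)$. For a loss $L:\Delta^C\times\mathcal{Y}\to\mathbb{R}$: inner risk $\mathcal{C}_{L,P,x}(q)=\mathbb{E}_{Y\sim P(\cdot\mid x)}L(q,Y)$, minimal inner risk $\mathcal{C}^*_{L,P,x}=\inf_{q\in\Delta^C}\mathcal{C}_{L,P,x}(q)$; risk $\mathcal{R}_{L,P}(f)=\mathbb{E}_P[L(f(X),Y)]$ and Bayes risk $\mathcal{R}^*_{L,P}=\inf_{f\in\mathcal{F}}\mathcal{R}_{L,P}(f)$. A loss $\ell$ is proper if $\mathcal{C}^*_{\ell,P,x}=\mathcal{C}_{\ell,P,x}(\eta(x))$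 for all probability measures $P$ on $\mathcal{X}\times\mathcal{Y}$ and all $x\in\mathcal{X}$ (i.e. $q\mapsto\sum_c p_c\ell(q,c)$ is minimized over $\Delta^C$ at $q=p$, for every $p\in\Delta^C$); it is strictly proper if in addition this minimizer is always unique. It is continuous if $\ell(\cdot,c)$ is continuous on $\Delta^C$ for each $c$. The $0$-$1$ loss is $L(q,c)=\mathbf{1}_{c\neq\min\{\arg\max_j q_j\}}$. The forward correction loss of $\ell$ is $\ell_T(q,c)=\ell(Tq,c)$. *)

theory Defs
  imports "HOL-Probability.Probability"
begin

text \<open>
  The label set \<open>{1, \<dots>, C}\<close> is an arbitrary finite linearly ordered type \<open>'c\<close> with \<open>C = CARD('c)\<close>; the
  order is only needed for breaking ties in the 0-1 loss.  The feature space is the measurable space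
  underlying \<open>M :: 'x measure\<close> (only \<open>space M\<close> and \<open>sets M\<close> are used).
\<close>

definition prob_simplex :: "(real ^ 'n) set"
  where "prob_simplex = {p. (\<forall>i. 0 \<le> p $ i) \<and> (\<Sum>i\<in>UNIV. p $ i) = 1}"

definition column_stochastic :: "real ^ 'c ^ 'c \<Rightarrow> bool"
  where "column_stochastic T \<longleftrightarrow> (\<forall>j. column j T \<in> prob_simplex)"

definition predictors :: "'x measure \<Rightarrow> ('x \<Rightarrow> real ^ 'c) set"
  where "predictors M = measurable M (restrict_space borel prob_simplex)"

definition joint_distributions :: "'x measure \<Rightarrow> ('x \<times> 'c) measure set"
  where "joint_distributions M = {P. prob_space P \<and> sets P = sets (M \<Otimes>\<^sub>M count_space UNIV)}"

text \<open>Since the label type is finite, a probability measure on it is the same as a \<open>pmf\<close>.\<close>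

definition regular_cond_dist :: "'x measure \<Rightarrow> ('x \<times> 'c) measure \<Rightarrow> ('x \<Rightarrow> 'c pmf) \<Rightarrow> bool"
  where "regular_cond_dist M P K \<longleftrightarrow>
    (\<forall>c. (\<lambda>x. pmf (K x) c) \<in> borel_measurable M) \<and>
    (\<forall>A\<in>sets M. \<forall>c. emeasure P (A \<times> {c}) =
       (\<integral>\<^sup>+x\<in>A. ennreal (pmf (K x) c) \<partial>distr P M fst))"

definition class_probs :: "'c pmf \<Rightarrow> real ^ 'c"
  where "class_probs k = (\<chi> c. pmf k c)"

type_synonym 'c loss = "real ^ 'c \<Rightarrow> 'c \<Rightarrow> real"

definition inner_risk :: "'c::finite loss \<Rightarrow> 'c pmf \<Rightarrow> real ^ 'c \<Rightarrow> real"
  where "inner_risk l k q = measure_pmf.expectation k (\<lambda>y. l q y)"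

definition min_inner_risk :: "'c::finite loss \<Rightarrow> 'c pmf \<Rightarrow> ereal"
  where "min_inner_risk l k = (INF q\<in>prob_simplex. ereal (inner_risk l k q))"

definition proper_loss :: "'x measure \<Rightarrow> 'c::finite loss \<Rightarrow> bool"
  where "proper_loss M l \<longleftrightarrow>
    (\<forall>P\<in>joint_distributions M. \<forall>K. regular_cond_dist M P K \<longrightarrow>
      (\<forall>x\<in>space M. min_inner_risk l (K x) = ereal (inner_risk l (K x) (class_probs (K x)))))"

definition strictly_proper_loss :: "'x measure \<Rightarrow> 'c::finite loss \<Rightarrow> bool"
  where "strictly_proper_loss M l \<longleftrightarrow> proper_loss M l \<and>
    (\<forall>P\<in>joint_distributions M. \<forall>K. regular_cond_dist M P K \<longrightarrow>
      (\<forall>x\<in>space M. \<forall>q\<in>prob_simplex.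
        ereal (inner_risk l (K x) q) = min_inner_risk l (K x) \<longrightarrow> q = class_probs (K x)))"

definition continuous_loss :: "'c::finite loss \<Rightarrow> bool"
  where "continuous_loss l \<longleftrightarrow> (\<forall>c. continuous_on prob_simplex (\<lambda>q. l q c))"

definition zero_one_loss :: "'c::{finite,linorder} loss"
  where "zero_one_loss q c = of_bool (c \<noteq> Min {j. \<forall>k. q $ k \<le> q $ j})"

definition forward_loss :: "'c::finite loss \<Rightarrow> real ^ 'c ^ 'c \<Rightarrow> 'c loss"
  where "forward_loss l T q c = l (T *v q) c"

text \<open>
  The expectation is extended-real-valued (positive part minus negative part), so that finiteness of
  a Bayes risk is a genuine condition; the Bochner integral would return 0 for a non-integrable loss.
\<close>

definition risk :: "'c loss \<Rightarrow> ('x \<times> 'c) measure \<Rightarrow> ('x \<Rightarrow> real ^ 'c) \<Rightarrow> ereal"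
  where "risk l P f =
    enn2ereal (\<integral>\<^sup>+(x, y). ennreal (l (f x) y) \<partial>P) -
    enn2ereal (\<integral>\<^sup>+(x, y). ennreal (- l (f x) y) \<partial>P)"

definition bayes_risk :: "'x measure \<Rightarrow> 'c::finite loss \<Rightarrow> ('x \<times> 'c) measure \<Rightarrow> ereal"
  where "bayes_risk M l P = (INF f\<in>predictors M. risk l P f)"

text \<open>The joint law of \<open>((X, Y), Y')\<close>, with \<open>Y'\<close> the noisy label; see \<open>emeasure_noisy_joint\<close>.\<close>

definition noisy_joint :: "real ^ 'c ^ 'c \<Rightarrow> ('x \<times> 'c) measure \<Rightarrow> (('x \<times> 'c) \<times> 'c) measure"
  where "noisy_joint T P =
    density (P \<Otimes>\<^sub>M count_space UNIV) (\<lambda>((x, y), y'). ennreal (T $ y' $ y))"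

definition noisy :: "real ^ 'c ^ 'c \<Rightarrow> ('x \<times> 'c) measure \<Rightarrow> ('x \<times> 'c) measure"
  where "noisy T P = distr (noisy_joint T P) P (\<lambda>((x, y), y'). (x, y'))"

lemma emeasure_noisy_joint:
  fixes T :: "real ^ 'c::finite ^ 'c"
  assumes P: "P \<in> joint_distributions M" and A: "A \<in> sets M"
  shows "emeasure (noisy_joint T P) ((A \<times> {i}) \<times> {j}) = emeasure P (A \<times> {i}) * ennreal (T $ j $ i)"
proof -
  have sets_P[measurable_cong]: "sets P = sets (M \<Otimes>\<^sub>M count_space UNIV)"
    using P by (simp add: joint_distributions_def)
  interpret C: sigma_finite_measure "count_space (UNIV :: 'c set)"
    by (rule sigma_finite_measure_count_space_finite) simp
  have B: "A \<times> {i} \<in> sets P" "(A \<times> {i}) \<times> {j} \<in> sets (P \<Otimes>\<^sub>M count_space UNIV)"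
    using A by measurable
  have "snd \<in> measurable P (count_space (UNIV :: 'c set))"
    unfolding measurable_cong_sets[OF sets_P refl] by (rule measurable_snd)
  from measurable_compose[OF measurable_fst this]
  have y: "(\<lambda>z. snd (fst z)) \<in> measurable (P \<Otimes>\<^sub>M count_space UNIV) (count_space (UNIV :: 'c set))" .
  have m: "(\<lambda>((x, y), y'). ennreal (T $ y' $ y)) \<in> borel_measurable (P \<Otimes>\<^sub>M count_space UNIV)"
  proof -
    have "(\<lambda>z. ennreal (T $ snd z $ snd (fst z))) \<in> borel_measurable (P \<Otimes>\<^sub>M count_space UNIV)"
      by (rule measurable_compose_countable'[OF measurable_compose_countable'[OF _ y] measurable_snd])
        (auto simp: countable_finite)
    then show ?thesis
      by (simp add: case_prod_beta')
  qed
  have "emeasure (noisy_joint T P) ((A \<times> {i}) \<times> {j}) =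
      (\<integral>\<^sup>+z. ennreal (T $ j $ i) * indicator ((A \<times> {i}) \<times> {j}) z \<partial>(P \<Otimes>\<^sub>M count_space UNIV))"
    unfolding noisy_joint_def emeasure_density[OF m B(2)]
    by (intro nn_integral_cong) (auto simp: indicator_def)
  also have "\<dots> = ennreal (T $ j $ i) * (emeasure P (A \<times> {i}) * 1)"
    using B by (simp add: nn_integral_cmult_indicator C.emeasure_pair_measure_Times)
  finally show ?thesis by (simp add: mult.commute)
qed

definition multi_noise_risk ::
    "real ^ 'n \<Rightarrow> 'c::finite loss \<Rightarrow> ('n \<Rightarrow> real ^ 'c ^ 'c) \<Rightarrow>
      ('x \<times> 'c) measure \<Rightarrow> ('x \<Rightarrow> real ^ 'c) \<Rightarrow> ereal"
  where "multi_noise_risk w l T P f =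
    (\<Sum>i\<in>UNIV. ereal (w $ i) * risk (forward_loss l (T i)) (noisy (T i) P) f)"

definition multi_noise_bayes_risk ::
    "'x measure \<Rightarrow> real ^ 'n \<Rightarrow> 'c::finite loss \<Rightarrow> ('n \<Rightarrow> real ^ 'c ^ 'c) \<Rightarrow>
      ('x \<times> 'c) measure \<Rightarrow> ereal"
  where "multi_noise_bayes_risk M w l T P = (INF f\<in>predictors M. multi_noise_risk w l T P f)"

end

theory Submission
  imports Defs
begin

text \<open>
  Both regrets are integrals, over the marginal of the features, of functions of the posterior \<open>\<eta> x\<close>
  and the prediction \<open>f x\<close>. The pointwise surrogate regret \<open>D p q\<close> is continuous on the compact set
  of pairs in the simplex and, by strict properness and invertibility of the noise matrices, vanishes
  only for \<open>p = q\<close>; hence \<open>D p q \<ge> \<psi> e > 0\<close> as soon as the pointwise 0-1 regret \<open>E p q \<le> 2 * norm (p - q)\<close>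
  is at least \<open>e\<close>. Since \<open>E \<le> 1\<close>, this gives \<open>D \<ge> \<psi> e * (E - e)\<close>, and integrating it with \<open>e = s / 2\<close>
  for \<open>s\<close> the 0-1 regret yields \<open>\<theta> s = s / 2 * \<psi> (s / 2)\<close>.
\<close>

section \<open>Integration over a product with a finite label space\<close>

lemma measurable_pair_count_space_finite:
  fixes f :: "'a \<times> 'c::finite \<Rightarrow> 'b"
  assumes "\<And>c. (\<lambda>x. f (x, c)) \<in> measurable M N"
  shows "f \<in> measurable (M \<Otimes>\<^sub>M count_space UNIV) N"
proof -
  have "(\<lambda>z. f (fst z, snd z)) \<in> measurable (M \<Otimes>\<^sub>M count_space UNIV) N"
    by (rule measurable_compose_countable'[where I = UNIV and g = snd and f = "\<lambda>c z. f (fst z, c)"])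
      (auto intro: measurable_compose[OF measurable_fst assms] countable_finite)
  then show ?thesis by simp
qed

lemma nn_integral_pair_count_space_finite:
  fixes f :: "'a \<times> 'c::finite \<Rightarrow> ennreal"
  assumes "f \<in> borel_measurable (M \<Otimes>\<^sub>M count_space UNIV)"
  shows "(\<integral>\<^sup>+z. f z \<partial>(M \<Otimes>\<^sub>M count_space UNIV)) = (\<integral>\<^sup>+x. (\<Sum>c\<in>UNIV. f (x, c)) \<partial>M)"
proof -
  interpret C: sigma_finite_measure "count_space (UNIV :: 'c set)"
    by (rule sigma_finite_measure_count_space_finite) simp
  show ?thesis
    using C.nn_integral_fst[OF assms] by (simp add: nn_integral_count_space_finite)
qed

lemma integral_pair_count_space_finite:
  fixes f :: "'a \<times> 'c::finite \<Rightarrow> real"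
  assumes "finite_measure M" and "integrable (M \<Otimes>\<^sub>M count_space UNIV) f"
  shows "(\<integral>z. f z \<partial>(M \<Otimes>\<^sub>M count_space UNIV)) = (\<integral>x. (\<Sum>c\<in>UNIV. f (x, c)) \<partial>M)"
proof -
  interpret M: finite_measure M by fact
  interpret C: sigma_finite_measure "count_space (UNIV :: 'c set)"
    by (rule sigma_finite_measure_count_space_finite) simp
  interpret pair_sigma_finite M "count_space (UNIV :: 'c set)" ..
  show ?thesis
    using integral_fst'[OF assms(2)] by (simp add: lebesgue_integral_count_space_finite)
qed

lemma finite_measure_pair_count_space:
  assumes "finite_measure M"
  shows "finite_measure (M \<Otimes>\<^sub>M count_space (UNIV :: 'c::finite set))"
  by (intro finite_measure_pair_measure finite_measure_count_space assms) simp

section \<open>The simplex and measurable predictors\<close>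

lemma prob_simplex_le_1:
  assumes "p \<in> prob_simplex"
  shows "p $ i \<le> 1"
  using assms member_le_sum[of i UNIV "\<lambda>i. p $ i"] by (auto simp: prob_simplex_def)

lemma axis_in_prob_simplex: "axis i 1 \<in> prob_simplex"
  by (auto simp: prob_simplex_def axis_def)

lemma predictors_iff:
  "f \<in> predictors M \<longleftrightarrow> (\<forall>c. (\<lambda>x. f x $ c) \<in> borel_measurable M) \<and> (\<forall>x\<in>space M. f x \<in> prob_simplex)"
proof -
  have "f \<in> predictors M \<longleftrightarrow> f \<in> borel_measurable M \<and> (\<forall>x\<in>space M. f x \<in> prob_simplex)"
    by (auto simp: predictors_def measurable_restrict_space2_iff)
  moreover have "f \<in> borel_measurable M \<longleftrightarrow> (\<forall>c. (\<lambda>x. f x $ c) \<in> borel_measurable M)"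
    by (subst borel_measurable_euclidean_space)
      (auto simp: Basis_vec_def inner_axis)
  ultimately show ?thesis by simp
qed

section \<open>Existence of the posterior\<close>

text \<open>
  A regular conditional distribution, given as the density of the joint law with respect to the
  product of its marginal with the counting measure.
\<close>

lemma exists_class_posterior:
  fixes P :: "('x \<times> 'c::finite) measure"
  assumes P: "P \<in> joint_distributions M"
  obtains \<eta> where "\<eta> \<in> predictors M"
    and "P = density (distr P M fst \<Otimes>\<^sub>M count_space UNIV) (\<lambda>z. ennreal (\<eta> (fst z) $ snd z))"
proof -
  have sets_P: "sets P = sets (M \<Otimes>\<^sub>M count_space UNIV)" and "prob_space P"
    using P by (auto simp: joint_distributions_def)
  interpret P: prob_space P by fact
  have fst[measurable]: "fst \<in> measurable P M"
    unfolding measurable_cong_sets[OF sets_P refl] by (rule measurable_fst)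
  define D where "D = distr P M fst"
  define Q where "Q = D \<Otimes>\<^sub>M count_space (UNIV :: 'c set)"
  have sets_D: "sets D = sets M" by (simp add: D_def)
  have sets_Q: "sets Q = sets P"
    unfolding Q_def sets_P by (intro sets_pair_measure_cong sets_D refl)
  interpret D: prob_space D unfolding D_def by (rule P.prob_space_distr) fact
  interpret Q: finite_measure Q
    unfolding Q_def by (rule finite_measure_pair_count_space) unfold_locales
  have slice: "(\<lambda>x. h (x, c)) \<in> borel_measurable D" if "h \<in> borel_measurable Q"
    for h :: "_ \<Rightarrow> ennreal" and c
  proof -
    have "(\<lambda>x. (x, c)) \<in> measurable D Q" unfolding Q_def by measurable
    then show ?thesis using that by (rule measurable_compose)
  qed
  \<comment> \<open>Bounding the indicator at the actual label by the sum over all labels leaves an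
    integrand in the features alone, which integrates against the marginal. This domination makes
    \<open>P\<close> absolutely continuous with respect to \<open>Q\<close>.\<close>
  have "emeasure P N \<le> emeasure Q N" if N: "N \<in> sets Q" for N
  proof -
    have ind: "indicator N \<in> borel_measurable Q" using N by simp
    have "emeasure P N = (\<integral>\<^sup>+z. indicator N (fst z, snd z) \<partial>P)"
      using N sets_Q by simp
    also have "\<dots> \<le> (\<integral>\<^sup>+z. (\<Sum>c\<in>UNIV. indicator N (fst z, c)) \<partial>P)"
      by (intro nn_integral_mono member_le_sum) auto
    also have "\<dots> = (\<integral>\<^sup>+x. (\<Sum>c\<in>UNIV. indicator N (x, c)) \<partial>D)"
      unfolding D_def
      by (rule nn_integral_distr[symmetric]) (use slice[OF ind] in \<open>auto simp: D_def\<close>)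
    also have "\<dots> = emeasure Q N"
      using nn_integral_pair_count_space_finite[OF ind[unfolded Q_def]] N by (simp add: Q_def)
    finally show ?thesis .
  qed
  then have "absolutely_continuous Q P"
    by (force simp: absolutely_continuous_def null_sets_def sets_Q)
  from Q.Radon_Nikodym[OF this sets_Q[symmetric]] obtain F
    where F: "F \<in> borel_measurable Q" and PF: "P = density Q F" by auto
  note F' = slice[OF F]
  have nn_P: "(\<integral>\<^sup>+z. h z \<partial>P) = (\<integral>\<^sup>+x. (\<Sum>c\<in>UNIV. F (x, c) * h (x, c)) \<partial>D)"
    if "h \<in> borel_measurable Q" for h
    using that F nn_integral_pair_count_space_finite[of "\<lambda>z. F z * h z" D]
    by (simp add: PF nn_integral_density Q_def)
  \<comment> \<open>Summed over the labels, \<open>F\<close> is a density of the marginal with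
    respect to itself, so uniqueness of densities applies.\<close>
  have "AE x in D. (\<Sum>c\<in>UNIV. F (x, c)) = 1"
  proof (rule D.density_unique)
    show "density D (\<lambda>x. \<Sum>c\<in>UNIV. F (x, c)) = density D (\<lambda>_. 1)"
    proof (rule measure_eqI)
      fix A assume "A \<in> sets (density D (\<lambda>x. \<Sum>c\<in>UNIV. F (x, c)))"
      then have A: "A \<in> sets D" "A \<in> sets M" by (simp_all add: sets_D)
      have AQ: "(\<lambda>z. indicator A (fst z) :: ennreal) \<in> borel_measurable Q"
        unfolding Q_def using A by measurable
      have "emeasure (density D (\<lambda>x. \<Sum>c\<in>UNIV. F (x, c))) A
          = (\<integral>\<^sup>+x. (\<Sum>c\<in>UNIV. F (x, c)) * indicator A x \<partial>D)"
        using A F' by (intro emeasure_density) auto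
      also have "\<dots> = (\<integral>\<^sup>+z. indicator A (fst z) \<partial>P)"
        by (subst nn_P[OF AQ]) (simp add: sum_distrib_right)
      also have "\<dots> = emeasure D A"
        using nn_integral_distr[OF fst, of "indicator A"] A by (simp add: D_def)
      finally show "emeasure (density D (\<lambda>x. \<Sum>c\<in>UNIV. F (x, c))) A = emeasure (density D (\<lambda>_. 1)) A"
        using A by (simp add: emeasure_density)
    qed simp
  qed (use F' in auto)
  \<comment> \<open>Where the slices of \<open>F\<close> fail to sum to one, a vertex of the simplex
    is used, so that \<open>\<eta>\<close> lies in the simplex at every point and not just almost
    everywhere.\<close>
  define \<eta> where "\<eta> x = (if (\<Sum>c\<in>UNIV. F (x, c)) = 1 then (\<chi> c. enn2real (F (x, c))) else axis undefined 1)"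
    for x
  have F\<eta>: "ennreal (\<eta> x $ c) = F (x, c)" if "(\<Sum>c\<in>UNIV. F (x, c)) = 1" for x c
  proof -
    have "F (x, c) \<le> 1" using member_le_sum[of c UNIV "\<lambda>c. F (x, c)"] that by simp
    then have "F (x, c) < \<infinity>" by (rule le_less_trans) simp
    then show ?thesis using that by (simp add: \<eta>_def)
  qed
  have pred: "\<eta> \<in> predictors M"
    unfolding predictors_iff
  proof (intro conjI allI ballI)
    fix c
    have "(\<lambda>x. if (\<Sum>c\<in>UNIV. F (x, c)) = 1 then enn2real (F (x, c)) else axis undefined 1 $ c)
        \<in> borel_measurable D"
      using F' by measurable
    then have "(\<lambda>x. \<eta> x $ c) \<in> borel_measurable D"
      by (rule measurable_cong[THEN iffD1, rotated]) (simp add: \<eta>_def)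
    then show "(\<lambda>x. \<eta> x $ c) \<in> borel_measurable M"
      by (simp add: measurable_cong_sets[OF sets_D refl])
  next
    fix x
    show "\<eta> x \<in> prob_simplex"
    proof (cases "(\<Sum>c\<in>UNIV. F (x, c)) = 1")
      case True
      have nn: "0 \<le> \<eta> x $ c" for c using True by (simp add: \<eta>_def)
      have "ennreal (\<Sum>c\<in>UNIV. \<eta> x $ c) = 1"
        using True by (subst sum_ennreal[symmetric]) (simp_all add: nn F\<eta>)
      then have "(\<Sum>c\<in>UNIV. \<eta> x $ c) = 1" by (simp add: sum_nonneg nn)
      then show ?thesis using nn by (simp add: prob_simplex_def)
    qed (simp add: \<eta>_def axis_in_prob_simplex)
  qed
  have \<eta>m: "(\<lambda>z. ennreal (\<eta> (fst z) $ snd z)) \<in> borel_measurable Q"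
    unfolding Q_def
    by (intro measurable_pair_count_space_finite measurable_compose[OF _ measurable_ennreal])
      (use pred in \<open>simp add: predictors_iff measurable_cong_sets[OF sets_D refl]\<close>)
  \<comment> \<open>\<open>\<eta>\<close> can differ from \<open>F\<close> only over a null set of
    features, so it is still a density of \<open>P\<close>.\<close>
  have "P = density Q (\<lambda>z. ennreal (\<eta> (fst z) $ snd z))"
  proof (rule measure_eqI)
    fix A assume "A \<in> sets P"
    then have A: "A \<in> sets Q" by (simp add: sets_Q)
    then have ind: "indicator A \<in> borel_measurable Q" by simp
    have "emeasure P A = (\<integral>\<^sup>+z. indicator A z \<partial>P)" using A sets_Q by simp
    also have "\<dots> = (\<integral>\<^sup>+x. (\<Sum>c\<in>UNIV. F (x, c) * indicator A (x, c)) \<partial>D)"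
      by (rule nn_P[OF ind])
    also have "\<dots> = (\<integral>\<^sup>+x. (\<Sum>c\<in>UNIV. ennreal (\<eta> x $ c) * indicator A (x, c)) \<partial>D)"
      using \<open>AE x in D. (\<Sum>c\<in>UNIV. F (x, c)) = 1\<close>
      by (intro nn_integral_cong_AE) (auto simp: F\<eta>)
    also have "\<dots> = emeasure (density Q (\<lambda>z. ennreal (\<eta> (fst z) $ snd z))) A"
      using A \<eta>m nn_integral_pair_count_space_finite[of "\<lambda>z. ennreal (\<eta> (fst z) $ snd z) * indicator A z" D]
      by (simp add: emeasure_density Q_def)
    finally show "emeasure P A = emeasure (density Q (\<lambda>z. ennreal (\<eta> (fst z) $ snd z))) A" .
  qed (simp add: sets_Q)
  with pred show thesis by (intro that[of \<eta>]) (simp_all add: Q_def D_def)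
qed

section \<open>Integrals under the clean and the noisy law\<close>

lemma integral_posterior_density:
  fixes g :: "'x \<times> 'c::finite \<Rightarrow> real"
  assumes D: "prob_space D" "sets D = sets M" and \<eta>: "\<eta> \<in> predictors M"
    and g: "\<And>c. (\<lambda>x. g (x, c)) \<in> borel_measurable M"
      "\<And>x c. x \<in> space M \<Longrightarrow> \<bar>g (x, c)\<bar> \<le> B"
  shows "(\<integral>z. g z \<partial>density (D \<Otimes>\<^sub>M count_space UNIV) (\<lambda>z. ennreal (\<eta> (fst z) $ snd z)))
    = (\<integral>x. (\<Sum>c\<in>UNIV. \<eta> x $ c * g (x, c)) \<partial>D)"
proof -
  interpret D: prob_space D by fact
  interpret Q: finite_measure "D \<Otimes>\<^sub>M count_space (UNIV :: 'c set)"
    by (rule finite_measure_pair_count_space) unfold_locales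
  have spD: "space D = space M" by (rule sets_eq_imp_space_eq) fact
  have gm: "g \<in> borel_measurable (D \<Otimes>\<^sub>M count_space UNIV)"
    by (rule measurable_pair_count_space_finite) (simp add: g(1) measurable_cong_sets[OF D(2) refl])
  have \<eta>m: "(\<lambda>z. \<eta> (fst z) $ snd z) \<in> borel_measurable (D \<Otimes>\<^sub>M count_space UNIV)"
    by (rule measurable_pair_count_space_finite)
      (use \<eta> in \<open>simp add: predictors_iff measurable_cong_sets[OF D(2) refl]\<close>)
  have \<eta>b: "0 \<le> \<eta> x $ c" "\<eta> x $ c \<le> 1" if "x \<in> space M" for x c
    using \<eta> that prob_simplex_le_1[of "\<eta> x" c] by (auto simp: predictors_iff prob_simplex_def)
  \<comment> \<open>The posterior is at most one, so the weighted integrand inherits the bound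
    \<open>B\<close>; on a finite product this gives the integrability that Fubini requires.\<close>
  have "AE z in D \<Otimes>\<^sub>M count_space UNIV. norm (\<eta> (fst z) $ snd z * g z) \<le> B"
  proof (rule AE_I2)
    fix z assume "z \<in> space (D \<Otimes>\<^sub>M count_space (UNIV :: 'c set))"
    then have z: "fst z \<in> space M" by (auto simp: space_pair_measure spD)
    have "\<bar>\<eta> (fst z) $ snd z\<bar> * \<bar>g z\<bar> \<le> 1 * B"
      using \<eta>b[OF z, of "snd z"] g(2)[OF z, of "snd z"] by (intro mult_mono) auto
    then show "norm (\<eta> (fst z) $ snd z * g z) \<le> B" by (simp add: abs_mult)
  qed
  then have int: "integrable (D \<Otimes>\<^sub>M count_space UNIV) (\<lambda>z. \<eta> (fst z) $ snd z * g z)"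
    using gm \<eta>m by (intro Q.integrable_const_bound) auto
  have "(\<integral>z. g z \<partial>density (D \<Otimes>\<^sub>M count_space UNIV) (\<lambda>z. ennreal (\<eta> (fst z) $ snd z)))
      = (\<integral>z. \<eta> (fst z) $ snd z * g z \<partial>(D \<Otimes>\<^sub>M count_space UNIV))"
    using gm \<eta>m \<eta>b by (subst integral_density) (auto simp: space_pair_measure spD)
  also have "\<dots> = (\<integral>x. (\<Sum>c\<in>UNIV. \<eta> x $ c * g (x, c)) \<partial>D)"
    using integral_pair_count_space_finite[OF D.finite_measure_axioms int] by simp
  finally show ?thesis .
qed

text \<open>Summing out the noisy label first moves the noise from the measure to the integrand,
  where \<open>g\<close> is averaged under the column of \<open>T\<close> selected by the clean
  label.\<close>

lemma integral_noisy:
  fixes g :: "'x \<times> 'c::finite \<Rightarrow> real"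
  assumes P: "P \<in> joint_distributions M" and T: "column_stochastic T"
    and g: "\<And>c. (\<lambda>x. g (x, c)) \<in> borel_measurable M"
      "\<And>x c. x \<in> space M \<Longrightarrow> \<bar>g (x, c)\<bar> \<le> B"
  shows "integrable (noisy T P) g"
    and "(\<integral>z. g z \<partial>noisy T P) = (\<integral>z. (\<Sum>j\<in>UNIV. T $ j $ snd z * g (fst z, j)) \<partial>P)"
proof -
  have sets_P: "sets P = sets (M \<Otimes>\<^sub>M count_space UNIV)" and "prob_space P"
    using P by (auto simp: joint_distributions_def)
  interpret P: prob_space P by fact
  have space_P: "space P = space M \<times> UNIV"
    using sets_eq_imp_space_eq[OF sets_P] by (simp add: space_pair_measure)
  define Q where "Q = P \<Otimes>\<^sub>M count_space (UNIV :: 'c set)"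
  interpret Q: finite_measure Q
    unfolding Q_def by (rule finite_measure_pair_count_space) unfold_locales
  have Tb: "0 \<le> T $ j $ c" "T $ j $ c \<le> 1" for j c
    using T prob_simplex_le_1[of "column c T" j]
    by (auto simp: column_stochastic_def prob_simplex_def column_def)
  have gP: "g \<in> borel_measurable P"
    unfolding measurable_cong_sets[OF sets_P refl]
    by (rule measurable_pair_count_space_finite) (rule g)
  have fstP: "fst \<in> measurable P M" and sndP: "snd \<in> measurable P (count_space UNIV)"
    unfolding measurable_cong_sets[OF sets_P refl] by (rule measurable_fst measurable_snd)+
  have proj: "(\<lambda>z. (fst (fst z), snd z)) \<in> measurable Q P"
    unfolding measurable_cong_sets[OF refl sets_P] Q_def
    by (intro measurable_Pair measurable_snd measurable_compose[OF measurable_fst fstP])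
  have Tm: "(\<lambda>z. T $ snd z $ snd (fst z)) \<in> borel_measurable Q"
    unfolding Q_def
    by (rule measurable_pair_count_space_finite) (simp add: measurable_compose[OF sndP])
  have gQ: "(\<lambda>z. g (fst (fst z), snd z)) \<in> borel_measurable Q"
    by (rule measurable_compose[OF proj gP])
  have noisy: "noisy T P = distr (density Q (\<lambda>z. ennreal (T $ snd z $ snd (fst z)))) P
      (\<lambda>z. (fst (fst z), snd z))"
    by (simp add: noisy_def noisy_joint_def Q_def case_prod_beta')
  have int: "integrable Q (\<lambda>z. T $ snd z $ snd (fst z) * g (fst (fst z), snd z))"
  proof (rule Q.integrable_const_bound[of _ B])
    show "AE z in Q. norm (T $ snd z $ snd (fst z) * g (fst (fst z), snd z)) \<le> B"
    proof (rule AE_I2)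
      fix z assume "z \<in> space Q"
      then have z: "fst (fst z) \<in> space M" by (auto simp: space_pair_measure space_P Q_def)
      have "\<bar>T $ snd z $ snd (fst z)\<bar> * \<bar>g (fst (fst z), snd z)\<bar> \<le> 1 * B"
        using Tb g(2)[OF z] by (intro mult_mono) auto
      then show "norm (T $ snd z $ snd (fst z) * g (fst (fst z), snd z)) \<le> B" by (simp add: abs_mult)
    qed
  qed (use Tm gQ in auto)
  show "integrable (noisy T P) g"
    unfolding noisy using proj gP Tm gQ int Tb
    by (subst integrable_distr_eq) (auto simp: integrable_density)
  have "(\<integral>z. g z \<partial>noisy T P) = (\<integral>z. T $ snd z $ snd (fst z) * g (fst (fst z), snd z) \<partial>Q)"
    unfolding noisy using proj gP Tm gQ Tb
    by (subst integral_distr) (auto simp: integral_density)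
  also have "\<dots> = (\<integral>z. (\<Sum>j\<in>UNIV. T $ j $ snd z * g (fst z, j)) \<partial>P)"
    using integral_pair_count_space_finite[OF P.finite_measure_axioms int[unfolded Q_def]]
    by (simp add: Q_def)
  finally show "(\<integral>z. g z \<partial>noisy T P) = (\<integral>z. (\<Sum>j\<in>UNIV. T $ j $ snd z * g (fst z, j)) \<partial>P)" .
qed

text \<open>Integrability makes the positive and the negative part finite, so the extended
  difference in \<open>risk\<close> is not of the form
  \<open>\<infinity> - \<infinity>\<close>.\<close>

lemma risk_eq_integral:
  assumes "integrable P (\<lambda>z. L (f (fst z)) (snd z))"
  shows "risk L P f = ereal (\<integral>z. L (f (fst z)) (snd z) \<partial>P)"
proof -
  let ?h = "\<lambda>z. L (f (fst z)) (snd z)"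
  have fin: "(\<integral>\<^sup>+z. ennreal (?h z) \<partial>P) \<noteq> \<infinity>" "(\<integral>\<^sup>+z. ennreal (- ?h z) \<partial>P) \<noteq> \<infinity>"
    using assms by (auto simp: real_integrable_def)
  then have "enn2ereal (\<integral>\<^sup>+z. ennreal (?h z) \<partial>P) = ereal (enn2real (\<integral>\<^sup>+z. ennreal (?h z) \<partial>P))"
    "enn2ereal (\<integral>\<^sup>+z. ennreal (- ?h z) \<partial>P) = ereal (enn2real (\<integral>\<^sup>+z. ennreal (- ?h z) \<partial>P))"
    by (simp_all add: enn2ereal_ennreal[symmetric] less_top)
  then show ?thesis
    by (simp add: risk_def case_prod_beta' real_lebesgue_integral_def[OF assms])
qed

section \<open>The simplex under noise, and strict properness of conditional risks\<close>

lemma compact_prob_simplex: "compact (prob_simplex :: (real ^ 'n) set)"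
proof -
  have "closed {p :: real ^ 'n. (\<forall>i. 0 \<le> p $ i) \<and> (\<Sum>i\<in>UNIV. p $ i) = 1}"
    by (intro closed_Collect_conj closed_Collect_all closed_Collect_le closed_Collect_eq continuous_intros)
  moreover have "bounded (prob_simplex :: (real ^ 'n) set)"
  proof (rule boundedI)
    fix p :: "real ^ 'n" assume p: "p \<in> prob_simplex"
    have "norm p \<le> (\<Sum>i\<in>UNIV. \<bar>p $ i\<bar>)" by (rule norm_le_l1_cart)
    then show "norm p \<le> 1" using p by (simp add: prob_simplex_def)
  qed
  ultimately show ?thesis by (simp add: compact_eq_bounded_closed prob_simplex_def)
qed

lemma column_stochastic_mult:
  assumes "column_stochastic T" "p \<in> prob_simplex"
  shows "T *v p \<in> prob_simplex"
proof -
  have T: "0 \<le> T $ j $ c" "(\<Sum>j\<in>UNIV. T $ j $ c) = 1" for j c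
    using assms(1) by (auto simp: column_stochastic_def prob_simplex_def column_def)
  have "(\<Sum>j\<in>UNIV. (T *v p) $ j) = (\<Sum>c\<in>UNIV. (\<Sum>j\<in>UNIV. T $ j $ c) * p $ c)"
    unfolding matrix_vector_mult_def by (simp add: sum_distrib_right) (rule sum.swap)
  then show ?thesis
    using assms(2) T by (auto simp: prob_simplex_def matrix_vector_mult_def intro!: sum_nonneg)
qed

text \<open>The inner risk with the label distribution given as a vector: \<open>T *v p\<close> can
  be inserted without passing back to a \<open>pmf\<close>, and continuity in \<open>p\<close>
  refers to the Euclidean topology.\<close>

definition cond_risk :: "'c::finite loss \<Rightarrow> real ^ 'c \<Rightarrow> real ^ 'c \<Rightarrow> real"
  where "cond_risk l p q = (\<Sum>c\<in>UNIV. p $ c * l q c)"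

lemma inner_risk_eq_cond_risk: "inner_risk l k q = cond_risk l (class_probs k) q"
  unfolding inner_risk_def cond_risk_def class_probs_def
  by (subst integral_measure_pmf_real[of UNIV]) (auto simp: mult.commute)

lemma exists_class_probs:
  assumes "p \<in> prob_simplex"
  obtains k where "class_probs k = p"
proof
  have "pmf (embed_pmf (\<lambda>c. p $ c)) c = p $ c" for c
    using assms
    by (intro pmf_embed_pmf)
      (auto simp: prob_simplex_def nn_integral_count_space_finite sum_ennreal)
  then show "class_probs (embed_pmf (\<lambda>c. p $ c)) = p" by (simp add: class_probs_def vec_eq_iff)
qed

text \<open>
  A label distribution is the posterior at a point \<open>x\<close> for the law with features concentrated
  at \<open>x\<close>, which turns (strict) properness into a statement about the simplex.
\<close>

lemma exists_joint_distribution_const: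
  fixes k :: "'c::finite pmf"
  assumes x: "x \<in> space M"
  obtains P where "P \<in> joint_distributions M" "regular_cond_dist M P (\<lambda>_. k)"
proof -
  define D where "D = return M x"
  define P where "P = D \<Otimes>\<^sub>M measure_pmf k"
  have D: "prob_space D" "sets D = sets M"
    using x by (auto simp: D_def prob_space_return)
  interpret D: prob_space D by fact
  interpret pair_prob_space D "measure_pmf k" ..
  have sets_P: "sets P = sets (M \<Otimes>\<^sub>M count_space UNIV)"
    unfolding P_def by (intro sets_pair_measure_cong D) simp
  have fst: "fst \<in> measurable P M"
    unfolding measurable_cong_sets[OF sets_P refl] by (rule measurable_fst)
  have times: "emeasure P (A \<times> B) = emeasure D A * emeasure (measure_pmf k) B" if "A \<in> sets M" for A B
    unfolding P_def using that D by (intro measure_pmf.emeasure_pair_measure_Times) auto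
  have marg: "distr P M fst = D"
  proof (rule measure_eqI)
    fix A assume "A \<in> sets (distr P M fst)"
    then have A: "A \<in> sets M" by simp
    have "fst -` A \<inter> space P = A \<times> UNIV"
      using sets.sets_into_space[OF A] sets_eq_imp_space_eq[OF sets_P]
      by (auto simp: space_pair_measure)
    then show "emeasure (distr P M fst) A = emeasure D A"
      using A fst times[OF A, of UNIV] measure_pmf.emeasure_space_1 by (simp add: emeasure_distr)
  qed (simp add: D)
  show thesis
  proof (rule that)
    show "P \<in> joint_distributions M"
      using sets_P P.prob_space_axioms by (simp add: joint_distributions_def P_def)
    show "regular_cond_dist M P (\<lambda>_. k)"
      unfolding regular_cond_dist_def marg
    proof (intro conjI allI ballI)
      fix A c assume A: "A \<in> sets M"
      show "emeasure P (A \<times> {c}) = (\<integral>\<^sup>+x\<in>A. ennreal (pmf k c) \<partial>D)"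
        using A D times[OF A, of "{c}"]
        by (simp add: emeasure_pmf_single nn_integral_cmult_indicator) (rule mult.commute)
    qed simp
  qed
qed

text \<open>Any \<open>p\<close> is the label law at \<open>x\<close> for some joint distribution,
  so the assumption on all \<open>P\<close> specialises to every point of the simplex. A point
  \<open>x\<close> must exist, since over an empty feature space strict properness is
  vacuous.\<close>

lemma strictly_proper_lossD:
  fixes l :: "'c::finite loss"
  assumes l: "strictly_proper_loss M l" and x: "x \<in> space M"
    and p: "p \<in> prob_simplex" and q: "q \<in> prob_simplex"
  shows "cond_risk l p p \<le> cond_risk l p q"
    and "cond_risk l p q = cond_risk l p p \<Longrightarrow> q = p"
proof -
  obtain k where k: "class_probs k = p" using exists_class_probs[OF p] .
  obtain P where P: "P \<in> joint_distributions M" "regular_cond_dist M P (\<lambda>_. k)"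
    using exists_joint_distribution_const[OF x] .
  have "min_inner_risk l k = ereal (inner_risk l k (class_probs k))"
    using l P x unfolding strictly_proper_loss_def proper_loss_def by blast
  then have min: "min_inner_risk l k = ereal (cond_risk l p p)"
    by (simp add: inner_risk_eq_cond_risk k)
  have "ereal (inner_risk l k q) = min_inner_risk l k \<Longrightarrow> q = class_probs k"
    using l P x q unfolding strictly_proper_loss_def by blast
  then have uniq: "ereal (cond_risk l p q) = min_inner_risk l k \<Longrightarrow> q = p"
    by (simp add: inner_risk_eq_cond_risk k)
  have "min_inner_risk l k \<le> ereal (cond_risk l p q)"
    unfolding min_inner_risk_def using q by (intro INF_lower2[of q]) (auto simp: inner_risk_eq_cond_risk k)
  then show "cond_risk l p p \<le> cond_risk l p q" by (simp add: min)
  show "q = p" if "cond_risk l p q = cond_risk l p p"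
    using uniq that by (simp add: min)
qed

text \<open>The integrand of the multi-noise risk at a feature with posterior \<open>p\<close> and
  prediction \<open>q\<close>.\<close>

definition multi_cond_risk ::
    "real ^ 'n \<Rightarrow> 'c::finite loss \<Rightarrow> ('n \<Rightarrow> real ^ 'c ^ 'c) \<Rightarrow> real ^ 'c \<Rightarrow> real ^ 'c \<Rightarrow> real"
  where "multi_cond_risk w l T p q = (\<Sum>i\<in>UNIV. w $ i * cond_risk l (T i *v p) (T i *v q))"

text \<open>Noise maps the simplex into itself, so every summand is minimal at \<open>q = p\<close>.
  Equality of the sums forces equality in each summand; for one with nonzero weight, strict
  properness gives \<open>T i *v q = T i *v p\<close>, and a left inverse cancels
  \<open>T i\<close>.\<close>

lemma multi_cond_risk_strictly_proper:
  fixes l :: "'c::finite loss" and T :: "'n::finite \<Rightarrow> real ^ 'c ^ 'c"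
  assumes T: "\<And>i. column_stochastic (T i)" "\<And>i. invertible (T i)"
    and l: "strictly_proper_loss M l" and w: "w \<in> prob_simplex" and x: "x \<in> space M"
    and pq: "p \<in> prob_simplex" "q \<in> prob_simplex"
  shows "multi_cond_risk w l T p p \<le> multi_cond_risk w l T p q"
    and "multi_cond_risk w l T p q = multi_cond_risk w l T p p \<Longrightarrow> q = p"
proof -
  have wsum: "(\<Sum>i\<in>UNIV. w $ i) = 1" and wnn: "0 \<le> w $ i" for i
    using w by (auto simp: prob_simplex_def)
  note Tpq = column_stochastic_mult[OF T(1) pq(1)] column_stochastic_mult[OF T(1) pq(2)]
  have le: "w $ i * cond_risk l (T i *v p) (T i *v p) \<le> w $ i * cond_risk l (T i *v p) (T i *v q)" for i
    by (intro mult_left_mono strictly_proper_lossD(1)[OF l x] Tpq wnn)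
  then show "multi_cond_risk w l T p p \<le> multi_cond_risk w l T p q"
    unfolding multi_cond_risk_def by (rule sum_mono)
  assume eq: "multi_cond_risk w l T p q = multi_cond_risk w l T p p"
  obtain i where i: "w $ i \<noteq> 0"
    using wsum by (metis sum.neutral zero_neq_one)
  have "w $ i * cond_risk l (T i *v p) (T i *v p) = w $ i * cond_risk l (T i *v p) (T i *v q)"
    using sum_mono_inv[OF eq[unfolded multi_cond_risk_def, symmetric] le, of i] by simp
  then have "T i *v q = T i *v p"
    using i by (intro strictly_proper_lossD(2)[OF l x Tpq]) simp
  moreover obtain T' where "T' ** T i = mat 1" using T(2)[of i] by (auto simp: invertible_def)
  ultimately show "q = p"
    by (metis matrix_vector_mul_assoc matrix_vector_mul_lid)
qed

text \<open>The second argument has to stay in the simplex, which \<open>T i\<close> preserves,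
  because the loss is continuous there; the dependence on the first argument is linear.\<close>

lemma continuous_on_multi_cond_risk:
  fixes l :: "'c::finite loss" and T :: "'n::finite \<Rightarrow> real ^ 'c ^ 'c"
  assumes T: "\<And>i. column_stochastic (T i)" and l: "continuous_loss l"
    and f: "continuous_on S f" and g: "continuous_on S g" and gS: "g ` S \<subseteq> prob_simplex"
  shows "continuous_on S (\<lambda>z. multi_cond_risk w l T (f z) (g z))"
proof -
  have lin: "continuous_on S (\<lambda>z. T i *v h z)" if "continuous_on S h" for i and h :: "_ \<Rightarrow> real ^ 'c"
    using that by (rule bounded_linear.continuous_on[OF matrix_vector_mul_bounded_linear])
  have "continuous_on S (\<lambda>z. l (T i *v g z) c)" for i c
    using l column_stochastic_mult[OF T] gS
    by (intro continuous_on_compose2[OF _ lin[OF g], of prob_simplex "\<lambda>q. l q c"])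
      (auto simp: continuous_loss_def)
  then show ?thesis
    unfolding multi_cond_risk_def cond_risk_def
    by (intro continuous_intros lin[OF f])
qed

section \<open>A modulus comparing two functions on a compact set\<close>

text \<open>
  Adding the penalty \<open>max 0 (e - N z)\<close> instead of restricting the infimum to \<open>e \<le> N z\<close> makes \<open>\<psi>\<close>
  1-Lipschitz.
\<close>

lemma exists_continuous_modulus:
  fixes D N :: "'a::topological_space \<Rightarrow> real"
  assumes Z: "compact Z" "Z \<noteq> {}" and D: "continuous_on Z D" and N: "continuous_on Z N"
    and Dnn: "\<And>z. z \<in> Z \<Longrightarrow> 0 \<le> D z" and D0: "\<And>z. z \<in> Z \<Longrightarrow> D z = 0 \<Longrightarrow> N z \<le> 0"
  obtains \<psi> :: "real \<Rightarrow> real" where "continuous_on UNIV \<psi>" "mono \<psi>" "\<And>e. 0 \<le> \<psi> e" "\<And>e. 0 < e \<Longrightarrow> 0 < \<psi> e"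
    "\<And>e z. z \<in> Z \<Longrightarrow> e \<le> N z \<Longrightarrow> \<psi> e \<le> D z"
proof -
  define G where "G e z = D z + max 0 (e - N z)" for e z
  define \<psi> where "\<psi> e = (INF z\<in>Z. G e z)" for e
  have bdd: "bdd_below (G e ` Z)" for e
    by (rule bdd_belowI2[of _ 0]) (use Dnn in \<open>auto simp: G_def\<close>)
  have attained: "\<exists>z\<in>Z. \<psi> e = G e z" for e
  proof -
    have "continuous_on Z (G e)" unfolding G_def by (intro continuous_intros D N)
    from continuous_attains_inf[OF Z this] obtain z where z: "z \<in> Z" "\<And>y. y \<in> Z \<Longrightarrow> G e z \<le> G e y"
      by auto
    then have "\<psi> e = G e z" unfolding \<psi>_def by (intro cInf_eq_minimum) auto
    with z show ?thesis by blast
  qed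
  have lower: "\<psi> e \<le> G e z" if "z \<in> Z" for e z
    unfolding \<psi>_def by (rule cINF_lower[OF bdd that])
  have shift: "\<psi> e \<le> \<psi> e' + \<bar>e - e'\<bar>" for e e'
  proof -
    \<comment> \<open>The minimizer for \<open>e'\<close> is a competitor for \<open>e\<close>, and
      the penalty is 1-Lipschitz in the threshold.\<close>
    obtain z where z: "z \<in> Z" "\<psi> e' = G e' z" using attained by blast
    have "G e z \<le> G e' z + \<bar>e - e'\<bar>" by (auto simp: G_def)
    then show ?thesis using lower[OF z(1), of e] z(2) by linarith
  qed
  show thesis
  proof
    have "1-lipschitz_on UNIV \<psi>"
    proof (rule lipschitz_onI)
      fix e e' show "dist (\<psi> e) (\<psi> e') \<le> 1 * dist e e'"
        using shift[of e e'] shift[of e' e] by (simp add: dist_real_def)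
    qed simp
    then show "continuous_on UNIV \<psi>" by (rule lipschitz_on_continuous_on)
    show "mono \<psi>"
    proof (rule monoI)
      fix e e' :: real assume "e \<le> e'"
      obtain z where z: "z \<in> Z" "\<psi> e' = G e' z" using attained by blast
      have "G e z \<le> G e' z" using \<open>e \<le> e'\<close> by (auto simp: G_def)
      then show "\<psi> e \<le> \<psi> e'" using lower[OF z(1), of e] z(2) by linarith
    qed
  next
    fix e :: real
    obtain z where "z \<in> Z" "\<psi> e = G e z" using attained by blast
    then show "0 \<le> \<psi> e" using Dnn[of z] by (simp add: G_def)
  next
    fix e :: real assume "0 < e"
    \<comment> \<open>At a minimizer either \<open>D z > 0\<close>, or \<open>D z = 0\<close> and
      then \<open>N z \<le> 0\<close> makes the penalty at least \<open>e\<close>.\<close>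
    obtain z where "z \<in> Z" "\<psi> e = G e z" using attained by blast
    then show "0 < \<psi> e" using Dnn[of z] D0[of z] \<open>0 < e\<close> by (cases "D z = 0") (auto simp: G_def)
  next
    fix e z assume "z \<in> Z" "e \<le> N z"
    then show "\<psi> e \<le> D z" using lower[of z e] by (simp add: G_def)
  qed
qed

section \<open>Continuous losses along predictors\<close>

lemma column_stochastic_mult_predictors:
  assumes "column_stochastic T" "f \<in> predictors M"
  shows "(\<lambda>x. T *v f x) \<in> predictors M"
  using assms column_stochastic_mult[OF assms(1)]
  by (auto simp: predictors_iff matrix_vector_mult_def
      intro!: borel_measurable_sum borel_measurable_times)

lemma continuous_loss_measurable:
  assumes "continuous_loss l" "f \<in> predictors M"
  shows "(\<lambda>x. l (f x) c) \<in> borel_measurable M"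
proof (rule measurable_compose[where g = "\<lambda>q. l q c"])
  show "f \<in> measurable M (restrict_space borel prob_simplex)"
    using assms(2) by (simp add: predictors_def)
  show "(\<lambda>q. l q c) \<in> borel_measurable (restrict_space borel prob_simplex)"
    using assms(1) by (intro borel_measurable_continuous_on_restrict) (simp add: continuous_loss_def)
qed

text \<open>Finitely many continuous images of the compact simplex have a common bound, which makes
  the surrogate losses integrable under every law.\<close>

lemma continuous_loss_bounded:
  fixes l :: "'c::finite loss"
  assumes "continuous_loss l"
  obtains B where "\<And>q c. q \<in> prob_simplex \<Longrightarrow> \<bar>l q c\<bar> \<le> B"
proof -
  have "bounded (\<Union>c. (\<lambda>q. l q c) ` prob_simplex)"
    using assms unfolding continuous_loss_def
    by (intro bounded_UN) (auto intro!: compact_imp_bounded compact_continuous_image compact_prob_simplex)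
  then obtain B where "\<forall>z\<in>(\<Union>c. (\<lambda>q. l q c) ` prob_simplex). norm z \<le> B"
    unfolding bounded_iff by blast
  then show thesis by (intro that[of B]) auto
qed

section \<open>The 0-1 loss and its pointwise regret\<close>

definition predicted_class :: "real ^ 'c::{finite,linorder} \<Rightarrow> 'c::{finite,linorder}"
  where "predicted_class q = Min {j. \<forall>k. q $ k \<le> q $ j}"

lemma predicted_class_maximal: "q $ k \<le> q $ predicted_class q"
proof -
  have "Max (range (($) q)) \<in> range (($) q)" by (rule Max_in) auto
  then obtain j where "q $ j = Max (range (($) q))" by force
  then have "q $ k \<le> q $ j" for k by simp
  then have "predicted_class q \<in> {j. \<forall>k. q $ k \<le> q $ j}"
    unfolding predicted_class_def by (intro Min_in) auto
  then show ?thesis by simp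
qed

text \<open>Replaces the \<open>Min\<close> of an argmax set by comparisons of coordinates, from
  which measurability of the predicted class can be read off.\<close>

lemma predicted_class_eq_iff:
  "predicted_class q = c \<longleftrightarrow> (\<forall>k. q $ k \<le> q $ c) \<and> (\<forall>d. d < c \<longrightarrow> (\<exists>k. q $ d < q $ k))"
proof
  assume "predicted_class q = c"
  moreover have "predicted_class q \<le> d" if "\<forall>k. q $ k \<le> q $ d" for d
    unfolding predicted_class_def using that by (intro Min_le) auto
  ultimately show "(\<forall>k. q $ k \<le> q $ c) \<and> (\<forall>d. d < c \<longrightarrow> (\<exists>k. q $ d < q $ k))"
    using predicted_class_maximal by (metis leD leI)
next
  assume "(\<forall>k. q $ k \<le> q $ c) \<and> (\<forall>d. d < c \<longrightarrow> (\<exists>k. q $ d < q $ k))"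
  then show "predicted_class q = c"
    unfolding predicted_class_def by (intro Min_eqI) (auto simp: not_less[symmetric])
qed

lemma zero_one_loss_eq: "zero_one_loss q c = of_bool (c \<noteq> predicted_class q)"
  by (simp add: zero_one_loss_def predicted_class_def)

lemma zero_one_loss_measurable:
  fixes f :: "'x \<Rightarrow> real ^ 'c::{finite,linorder}"
  assumes "f \<in> predictors M"
  shows "(\<lambda>x. zero_one_loss (f x) c) \<in> borel_measurable M"
proof -
  have [measurable]: "(\<lambda>x. f x $ c) \<in> borel_measurable M" for c
    using assms by (simp add: predictors_iff)
  \<comment> \<open>The quantifiers are bounded by finite sets so that the measurability rules for
    finite conjunctions and disjunctions apply.\<close>
  have "Measurable.pred M (\<lambda>x. (\<forall>k\<in>UNIV. f x $ k \<le> f x $ c) \<and>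
      (\<forall>d\<in>{..<c}. \<exists>k\<in>UNIV. f x $ d < f x $ k))"
    by (intro pred_intros_logic pred_intros_finite) (simp_all, measurable)
  then have "Measurable.pred M (\<lambda>x. predicted_class (f x) = c)"
    by (simp add: predicted_class_eq_iff)
  then have "(\<lambda>x. if predicted_class (f x) = c then 0 else 1 :: real) \<in> borel_measurable M"
    by measurable
  then show ?thesis
    by (rule measurable_cong[THEN iffD1, rotated]) (auto simp: zero_one_loss_eq)
qed

lemma cond_risk_zero_one:
  assumes "p \<in> prob_simplex"
  shows "cond_risk zero_one_loss p q = 1 - p $ predicted_class q"
proof -
  have "cond_risk zero_one_loss p q = (\<Sum>c\<in>UNIV. p $ c - (if c = predicted_class q then p $ c else 0))"
    unfolding cond_risk_def by (intro sum.cong) (auto simp: zero_one_loss_eq)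
  then show ?thesis using assms by (simp add: sum_subtractf prob_simplex_def)
qed

text \<open>With \<open>a\<close> and \<open>b\<close> the classes predicted from \<open>p\<close>
  and \<open>q\<close>, the left side is
  \<open>(p $ a - q $ a) + (q $ a - q $ b) + (q $ b - p $ b)\<close>. The middle term is nonpositive
  by the choice of \<open>b\<close>; the outer ones are at most \<open>norm (p - q)\<close>.\<close>

lemma regret_le_norm: "p $ predicted_class p - p $ predicted_class q \<le> 2 * norm (p - q)"
  using predicted_class_maximal[of q "predicted_class p"]
    component_le_norm_cart[of "p - q" "predicted_class p"]
    component_le_norm_cart[of "p - q" "predicted_class q"]
  by simp

section \<open>Risks as integrals over the feature marginal\<close>

lemma integrable_cond_risk:
  fixes L :: "'c::finite loss"
  assumes D: "prob_space D" "sets D = sets M" and \<eta>: "\<eta> \<in> predictors M"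
    and L: "\<And>c. (\<lambda>x. L (f x) c) \<in> borel_measurable M"
      "\<And>x c. x \<in> space M \<Longrightarrow> \<bar>L (f x) c\<bar> \<le> B"
  shows "integrable D (\<lambda>x. cond_risk L (\<eta> x) (f x))"
  unfolding cond_risk_def
proof (rule Bochner_Integration.integrable_sum)
  interpret D: prob_space D by fact
  have spD: "space D = space M" by (rule sets_eq_imp_space_eq) fact
  fix c
  show "integrable D (\<lambda>x. \<eta> x $ c * L (f x) c)"
  proof (rule D.integrable_const_bound[of _ B])
    show "AE x in D. norm (\<eta> x $ c * L (f x) c) \<le> B"
    proof (rule AE_I2)
      fix x assume "x \<in> space D"
      then have x: "x \<in> space M" by (simp add: spD)
      have "\<bar>\<eta> x $ c\<bar> * \<bar>L (f x) c\<bar> \<le> 1 * B"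
        using \<eta> x prob_simplex_le_1[of "\<eta> x" c] L(2)[OF x]
        by (intro mult_mono) (auto simp: predictors_iff prob_simplex_def)
      then show "norm (\<eta> x $ c * L (f x) c) \<le> B" by (simp add: abs_mult)
    qed
    show "(\<lambda>x. \<eta> x $ c * L (f x) c) \<in> borel_measurable D"
      using \<eta> L(1)
      by (auto simp: predictors_iff measurable_cong_sets[OF D(2) refl] intro!: borel_measurable_times)
  qed
qed

text \<open>Measurability and boundedness along \<open>f\<close> take the place of continuity so
  that the 0-1 loss is covered, which may jump where the predicted class changes.\<close>

lemma risk_posterior_density:
  fixes L :: "'c::finite loss"
  assumes P: "P \<in> joint_distributions M" and \<eta>: "\<eta> \<in> predictors M"
    and D: "prob_space D" "sets D = sets M"
    and dens: "P = density (D \<Otimes>\<^sub>M count_space UNIV) (\<lambda>z. ennreal (\<eta> (fst z) $ snd z))"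
    and L: "\<And>c. (\<lambda>x. L (f x) c) \<in> borel_measurable M"
      "\<And>x c. x \<in> space M \<Longrightarrow> \<bar>L (f x) c\<bar> \<le> B"
  shows "risk L P f = ereal (\<integral>x. cond_risk L (\<eta> x) (f x) \<partial>D)"
proof -
  have sets_P: "sets P = sets (M \<Otimes>\<^sub>M count_space UNIV)" and "prob_space P"
    using P by (auto simp: joint_distributions_def)
  interpret P: prob_space P by fact
  have space_P: "space P = space M \<times> UNIV"
    using sets_eq_imp_space_eq[OF sets_P] by (simp add: space_pair_measure)
  have "integrable P (\<lambda>z. L (f (fst z)) (snd z))"
  proof (rule P.integrable_const_bound[of _ B])
    show "(\<lambda>z. L (f (fst z)) (snd z)) \<in> borel_measurable P"
      unfolding measurable_cong_sets[OF sets_P refl]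
      by (rule measurable_pair_count_space_finite) (simp add: L)
  qed (use L in \<open>auto simp: space_P\<close>)
  then have "risk L P f = ereal (\<integral>z. L (f (fst z)) (snd z) \<partial>P)" by (rule risk_eq_integral)
  also have "(\<integral>z. L (f (fst z)) (snd z) \<partial>P) = (\<integral>x. (\<Sum>c\<in>UNIV. \<eta> x $ c * L (f x) c) \<partial>D)"
    using integral_posterior_density[OF D \<eta>, of "\<lambda>z. L (f (fst z)) (snd z)" B] L
    by (simp add: dens)
  finally show ?thesis by (simp add: cond_risk_def)
qed

text \<open>The noise is first averaged into the loss, then the clean label is integrated out.
  Swapping the two finite sums collects the noise with the posterior as
  \<open>T *v \<eta> x\<close>, the conditional law of the noisy label.\<close>

lemma risk_forward_noisy:
  fixes l :: "'c::finite loss"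
  assumes P: "P \<in> joint_distributions M" and \<eta>: "\<eta> \<in> predictors M"
    and D: "prob_space D" "sets D = sets M"
    and dens: "P = density (D \<Otimes>\<^sub>M count_space UNIV) (\<lambda>z. ennreal (\<eta> (fst z) $ snd z))"
    and T: "column_stochastic T" and l: "continuous_loss l" and f: "f \<in> predictors M"
  shows "risk (forward_loss l T) (noisy T P) f = ereal (\<integral>x. cond_risk l (T *v \<eta> x) (T *v f x) \<partial>D)"
    and "integrable D (\<lambda>x. cond_risk l (T *v \<eta> x) (T *v f x))"
proof -
  obtain B where B: "\<And>q c. q \<in> prob_simplex \<Longrightarrow> \<bar>l q c\<bar> \<le> B"
    using continuous_loss_bounded[OF l] by blast
  note Tf = column_stochastic_mult_predictors[OF T f]
  have m: "(\<lambda>x. l (T *v f x) c) \<in> borel_measurable M" for c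
    by (rule continuous_loss_measurable[OF l Tf])
  have b: "\<bar>l (T *v f x) c\<bar> \<le> B" if "x \<in> space M" for x c
    using Tf that by (intro B) (simp add: predictors_iff)
  show "integrable D (\<lambda>x. cond_risk l (T *v \<eta> x) (T *v f x))"
    by (rule integrable_cond_risk[OF D column_stochastic_mult_predictors[OF T \<eta>], where L = l and B = B])
      (simp_all add: m b)
  define g where "g z = (\<Sum>j\<in>UNIV. T $ j $ snd z * l (T *v f (fst z)) j)" for z
  have gb: "\<bar>g (x, c)\<bar> \<le> (\<Sum>j\<in>UNIV. \<bar>T $ j $ c\<bar> * B)" if "x \<in> space M" for x c
    unfolding g_def using b[OF that]
    by (intro order_trans[OF sum_abs] sum_mono) (simp add: abs_mult mult_left_mono)
  \<comment> \<open>Each column is a probability vector, so averaging over the noisy label keeps the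
    bound \<open>B\<close>.\<close>
  have "(\<Sum>j\<in>UNIV. \<bar>T $ j $ c\<bar>) = 1" for c
    using T by (simp add: column_stochastic_def prob_simplex_def column_def)
  then have gb: "\<bar>g (x, c)\<bar> \<le> B" if "x \<in> space M" for x c
    using gb[OF that, of c] by (simp add: sum_distrib_right[symmetric])
  have "risk (forward_loss l T) (noisy T P) f = ereal (\<integral>z. l (T *v f (fst z)) (snd z) \<partial>noisy T P)"
    using integral_noisy(1)[OF P T, of "\<lambda>z. l (T *v f (fst z)) (snd z)" B] m b
    by (subst risk_eq_integral) (simp_all add: forward_loss_def)
  also have "(\<integral>z. l (T *v f (fst z)) (snd z) \<partial>noisy T P) = (\<integral>z. g z \<partial>P)"
    using integral_noisy(2)[OF P T, of "\<lambda>z. l (T *v f (fst z)) (snd z)" B] m b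
    by (simp add: g_def)
  also have "\<dots> = (\<integral>x. (\<Sum>c\<in>UNIV. \<eta> x $ c * g (x, c)) \<partial>D)"
    using integral_posterior_density[OF D \<eta>, of g B] m gb
    by (simp add: dens g_def)
  also have "\<dots> = (\<integral>x. cond_risk l (T *v \<eta> x) (T *v f x) \<partial>D)"
  proof (rule Bochner_Integration.integral_cong)
    fix x
    have "(\<Sum>c\<in>UNIV. \<eta> x $ c * g (x, c))
        = (\<Sum>c\<in>UNIV. \<Sum>j\<in>UNIV. T $ j $ c * \<eta> x $ c * l (T *v f x) j)"
      by (simp add: g_def sum_distrib_left ac_simps)
    also have "\<dots> = cond_risk l (T *v \<eta> x) (T *v f x)"
      unfolding cond_risk_def matrix_vector_mult_def
      by (subst sum.swap) (simp add: sum_distrib_right)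
    finally show "(\<Sum>c\<in>UNIV. \<eta> x $ c * g (x, c)) = cond_risk l (T *v \<eta> x) (T *v f x)" .
  qed simp
  finally show "risk (forward_loss l T) (noisy T P) f = ereal (\<integral>x. cond_risk l (T *v \<eta> x) (T *v f x) \<partial>D)" .
qed

section \<open>The pointwise regret comparison\<close>

text \<open>
  For every threshold \<open>e\<close> the surrogate regret dominates an affine function of the 0-1 regret;
  unlike \<open>\<psi> (regret) \<le> surrogate regret\<close> this can be integrated without convexity of \<open>\<psi>\<close>.
\<close>

lemma exists_pointwise_regret_bound:
  fixes l :: "'c::{finite,linorder} loss"
    and T :: "'n::finite \<Rightarrow> real ^ 'c::{finite,linorder} ^ 'c::{finite,linorder}"
  assumes T: "\<And>i. column_stochastic (T i)" "\<And>i. invertible (T i)"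
    and l: "continuous_loss l" "strictly_proper_loss M l" and w: "w \<in> prob_simplex"
    and M: "space M \<noteq> {}"
  obtains \<psi> :: "real \<Rightarrow> real" where "continuous_on UNIV \<psi>" "mono \<psi>" "\<And>e. 0 < e \<Longrightarrow> 0 < \<psi> e"
    "\<And>e p q. 0 \<le> e \<Longrightarrow> p \<in> prob_simplex \<Longrightarrow> q \<in> prob_simplex \<Longrightarrow>
      \<psi> e * (p $ predicted_class p - p $ predicted_class q - e)
        \<le> multi_cond_risk w l T p q - multi_cond_risk w l T p p"
proof -
  let ?S = "prob_simplex :: (real ^ 'c::{finite,linorder}) set"
  let ?R = "multi_cond_risk w l T"
  obtain x where x: "x \<in> space M" using M by auto
  note proper = multi_cond_risk_strictly_proper[where T = T, OF T l(2) w x]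
  define G where "G z = ?R (fst z) (snd z) - ?R (fst z) (fst z)" for z
  \<comment> \<open>Scaled so that \<open>N (p, q)\<close> dominates the 0-1 regret, by
    \<open>regret_le_norm\<close>; it vanishes exactly on the diagonal.\<close>
  define N where "N z = 2 * norm (fst z - snd z)" for z :: "(real ^ 'c::{finite,linorder}) \<times> (real ^ 'c::{finite,linorder})"
  have "compact (?S \<times> ?S)" by (intro compact_Times compact_prob_simplex)
  moreover have "?S \<times> ?S \<noteq> {}" using axis_in_prob_simplex by auto
  moreover have "continuous_on (?S \<times> ?S) G"
    unfolding G_def by (intro continuous_intros continuous_on_multi_cond_risk T l) auto
  moreover have "continuous_on (?S \<times> ?S) N"
    unfolding N_def by (intro continuous_intros)
  moreover have "0 \<le> G z" "G z = 0 \<Longrightarrow> N z \<le> 0" if "z \<in> ?S \<times> ?S" for z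
    using that proper[of "fst z" "snd z"] by (auto simp: G_def N_def)
  ultimately obtain \<psi> where \<psi>: "continuous_on UNIV \<psi>" "mono \<psi>" "\<And>e. 0 \<le> \<psi> e" "\<And>e. 0 < e \<Longrightarrow> 0 < \<psi> e"
    "\<And>e z. z \<in> ?S \<times> ?S \<Longrightarrow> e \<le> N z \<Longrightarrow> \<psi> e \<le> G z"
    using exists_continuous_modulus[of "?S \<times> ?S" G N] by metis
  show thesis
  proof (rule that[OF \<psi>(1,2,4)])
    fix e :: real and p q assume e: "0 \<le> e" and p: "p \<in> ?S" and q: "q \<in> ?S"
    let ?E = "p $ predicted_class p - p $ predicted_class q"
    show "\<psi> e * (?E - e) \<le> ?R p q - ?R p p"
    proof (cases "?E \<le> e")
      case True
      then have "\<psi> e * (?E - e) \<le> 0" by (intro mult_nonneg_nonpos \<psi>(3)) simp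
      with proper(1)[OF p q] show ?thesis by linarith
    next
      case False
      \<comment> \<open>Here \<open>e < ?E \<le> N (p, q)\<close>, so the modulus applies; the
        factor \<open>?E - e\<close> is at most one and may be inserted on the smaller side.\<close>
      then have "\<psi> e \<le> G (p, q)"
        using regret_le_norm[of p q] p q by (intro \<psi>(5)) (auto simp: N_def)
      moreover have "?E - e \<le> 1"
        using e p prob_simplex_le_1[OF p, of "predicted_class p"]
        by (smt (verit) mem_Collect_eq prob_simplex_def)
      then have "\<psi> e * (?E - e) \<le> \<psi> e * 1" by (intro mult_left_mono \<psi>(3))
      ultimately show ?thesis by (simp add: G_def)
    qed
  qed
qed

text \<open>A probability space has a point. The case of no features is treated apart because strict
  properness carries information only at points of \<open>space M\<close>.\<close>

lemma joint_distributions_empty: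
  assumes "space M = {}"
  shows "joint_distributions M = {}"
  using assms prob_space.not_empty
  by (force simp: joint_distributions_def space_pair_measure dest!: sets_eq_imp_space_eq)

section \<open>The calibration function and integration of the pointwise bound\<close>

theorem theorem7:
  fixes M :: "'x measure"
    and l :: "'c::{finite,linorder} loss"
    and T :: "'n::finite \<Rightarrow> real ^ 'c::{finite,linorder} ^ 'c::{finite,linorder}"
    and w :: "real ^ 'n"
  assumes "\<And>i. column_stochastic (T i)"
    and "\<And>i. invertible (T i)"
    and "continuous_loss l"
    and "strictly_proper_loss M l"
    and "w \<in> prob_simplex"
  shows "\<exists>\<theta> :: ereal \<Rightarrow> ereal.
    \<theta> \<in> {0..1} \<rightarrow> {0..\<infinity>} \<and> strict_mono_on {0..1} \<theta> \<and> continuous_on {0..1} \<theta> \<and> \<theta> 0 = 0 \<and>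
    (\<forall>P\<in>joint_distributions M.
      (\<forall>i. bayes_risk M (forward_loss l (T i)) (noisy (T i) P) < \<infinity>) \<longrightarrow>
      (\<forall>f\<in>predictors M.
        \<theta> (risk zero_one_loss P f - bayes_risk M zero_one_loss P)
          \<le> multi_noise_risk w l T P f - multi_noise_bayes_risk M w l T P))"
proof (cases "space M = {}")
  case True
  \<comment> \<open>There is no joint distribution to consider, so any function of the required
    shape will do.\<close>
  have "(\<lambda>x. x) \<in> {0..1::ereal} \<rightarrow> {0..\<infinity>}" "strict_mono_on {0..1::ereal} (\<lambda>x. x)"
    by (auto simp: strict_mono_on_def)
  then show ?thesis
    by (intro exI[of _ "\<lambda>x. x"] conjI) (simp_all add: joint_distributions_empty[OF True])
next
  case False
  note T = assms(1,2) and l = assms(3,4) and w = assms(5)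
  let ?R = "multi_cond_risk w l T" and ?h = "predicted_class"
  obtain \<psi> where \<psi>: "continuous_on UNIV \<psi>" "mono \<psi>" "\<And>e. 0 < e \<Longrightarrow> 0 < \<psi> e"
    and bound: "\<And>e p q. 0 \<le> e \<Longrightarrow> p \<in> prob_simplex \<Longrightarrow> q \<in> prob_simplex \<Longrightarrow>
      \<psi> e * (p $ ?h p - p $ ?h q - e) \<le> ?R p q - ?R p p"
    by (rule exists_pointwise_regret_bound[where T = T, OF T l w False]) (rule that; blast)
  \<comment> \<open>The threshold \<open>s / 2\<close> in the pointwise bound leaves
    \<open>s - s / 2\<close> as the mean excess of the 0-1 regret, which is the first
    factor.\<close>
  define t where "t s = s / 2 * \<psi> (s / 2)" for s
  have t_less: "t s < t s'" if "0 \<le> s" "s < s'" for s s'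
  proof -
    \<comment> \<open>\<open>\<psi>\<close> is known to be monotone only in the weak sense;
      strictness comes from the linear factor together with
      \<open>\<psi> (s' / 2) > 0\<close>.\<close>
    have "s / 2 * \<psi> (s / 2) \<le> s / 2 * \<psi> (s' / 2)"
      using that by (intro mult_left_mono monoD[OF \<psi>(2)]) auto
    also have "\<dots> < s' / 2 * \<psi> (s' / 2)"
      using that \<psi>(3)[of "s' / 2"] by (intro mult_strict_right_mono) auto
    finally show ?thesis by (simp add: t_def)
  qed
  have t_nonneg: "0 \<le> t s" if "0 \<le> s" for s
    using t_less[of 0 s] that by (cases "s = 0") (auto simp: t_def)
  have t_cont: "continuous_on UNIV t"
    unfolding t_def by (intro continuous_intros continuous_on_compose2[OF \<psi>(1)]) auto
  \<comment> \<open>On \<open>{0..1}\<close> the conversion to reals loses nothing, so the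
    properties of \<open>t\<close> carry over.\<close>
  define \<theta> where "\<theta> e = ereal (t (real_of_ereal e))" for e
  have unit: "\<exists>s. e = ereal s \<and> 0 \<le> s" if "e \<in> {0..1}" for e :: ereal
    using that by (cases e) (auto simp: one_ereal_def)
  have "continuous_on {0..1::ereal} real_of_ereal"
    by (rule continuous_on_subset[OF continuous_on_real]) (auto simp: one_ereal_def dest: unit)
  then have "continuous_on {0..1} \<theta>"
    unfolding \<theta>_def by (intro continuous_on_ereal continuous_on_compose2[OF t_cont]) auto
  moreover have "strict_mono_on {0..1} \<theta>"
  proof (rule strict_mono_onI)
    fix a b :: ereal assume "a \<in> {0..1}" "b \<in> {0..1}" "a < b"
    then show "\<theta> a < \<theta> b"
      using unit[of a] unit[of b] by (auto simp: \<theta>_def intro!: t_less)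
  qed
  moreover have "\<theta> \<in> {0..1} \<rightarrow> {0..\<infinity>}"
    using unit t_nonneg by (fastforce simp: \<theta>_def)
  moreover have "\<theta> 0 = 0" by (simp add: \<theta>_def t_def zero_ereal_def)
  moreover have "\<theta> (risk zero_one_loss P f - bayes_risk M zero_one_loss P)
      \<le> multi_noise_risk w l T P f - multi_noise_bayes_risk M w l T P"
    if P: "P \<in> joint_distributions M" and f: "f \<in> predictors M" for P f
  proof -
    obtain \<eta> where \<eta>: "\<eta> \<in> predictors M"
      and dens: "P = density (distr P M fst \<Otimes>\<^sub>M count_space UNIV) (\<lambda>z. ennreal (\<eta> (fst z) $ snd z))"
      using exists_class_posterior[OF P] .
    define D where "D = distr P M fst"
    have sets_P: "sets P = sets (M \<Otimes>\<^sub>M count_space UNIV)" and "prob_space P"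
      using P by (auto simp: joint_distributions_def)
    have fstP: "fst \<in> measurable P M"
      unfolding measurable_cong_sets[OF sets_P refl] by (rule measurable_fst)
    have D: "prob_space D" "sets D = sets M"
      using prob_space.prob_space_distr[OF \<open>prob_space P\<close> fstP] by (simp_all add: D_def)
    interpret D: prob_space D by fact
    have spD: "space D = space M" by (rule sets_eq_imp_space_eq) fact
    note dens = dens[folded D_def]
    have simplex: "g x \<in> prob_simplex" if "g \<in> predictors M" "x \<in> space D" for g :: "'x \<Rightarrow> real ^ 'c::{finite,linorder}" and x
      using that by (simp add: predictors_iff spD)

    let ?C = "\<lambda>g x. cond_risk zero_one_loss (\<eta> x) (g x)"
    have zo_bound: "\<bar>zero_one_loss q c\<bar> \<le> 1" for q :: "real ^ 'c::{finite,linorder}" and c by (simp add: zero_one_loss_eq)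
    have zo_risk: "risk zero_one_loss P g = ereal (\<integral>x. ?C g x \<partial>D)"
      and zo_int: "integrable D (?C g)" if "g \<in> predictors M" for g
      using risk_posterior_density[OF P \<eta> D dens zero_one_loss_measurable[OF that] zo_bound]
        integrable_cond_risk[OF D \<eta> zero_one_loss_measurable[OF that] zo_bound] by auto
    have zo_min: "?C \<eta> x \<le> ?C g x" if "g \<in> predictors M" "x \<in> space D" for g x
      using simplex[OF \<eta> that(2)] predicted_class_maximal by (simp add: cond_risk_zero_one)
    \<comment> \<open>The posterior is a pointwise optimal predictor, so the infimum is attained at
      \<open>\<eta>\<close>.\<close>
    have "bayes_risk M zero_one_loss P = ereal (\<integral>x. ?C \<eta> x \<partial>D)"
    proof (rule antisym)
      show "bayes_risk M zero_one_loss P \<le> ereal (\<integral>x. ?C \<eta> x \<partial>D)"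
        unfolding bayes_risk_def using \<eta> by (intro INF_lower2[of \<eta>]) (auto simp: zo_risk)
      show "ereal (\<integral>x. ?C \<eta> x \<partial>D) \<le> bayes_risk M zero_one_loss P"
        unfolding bayes_risk_def
        by (intro INF_greatest) (auto simp: zo_risk intro!: integral_mono zo_int \<eta> zo_min)
    qed
    moreover define s where "s = (\<integral>x. (?C f x - ?C \<eta> x) \<partial>D)"
    ultimately have regret: "risk zero_one_loss P f - bayes_risk M zero_one_loss P = ereal s"
      using zo_int f \<eta> by (simp add: zo_risk)
    have s_nonneg: "0 \<le> s"
      unfolding s_def by (intro Bochner_Integration.integral_nonneg_AE AE_I2) (use zo_min[OF f] in auto)

    have multi_int: "integrable D (\<lambda>x. ?R (\<eta> x) (g x))"
      and multi_risk: "multi_noise_risk w l T P g = ereal (\<integral>x. ?R (\<eta> x) (g x) \<partial>D)"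
      if g: "g \<in> predictors M" for g
      using risk_forward_noisy[OF P \<eta> D dens T(1) l(1) g]
      by (simp_all add: multi_noise_risk_def multi_cond_risk_def)
    \<comment> \<open>\<open>\<eta>\<close> competes in the infimum, so subtracting its risk instead
      of the Bayes risk gives a lower bound on the surrogate regret.\<close>
    have "multi_noise_bayes_risk M w l T P \<le> multi_noise_risk w l T P \<eta>"
      unfolding multi_noise_bayes_risk_def by (rule INF_lower[OF \<eta>])
    then have "multi_noise_risk w l T P f - multi_noise_risk w l T P \<eta>
        \<le> multi_noise_risk w l T P f - multi_noise_bayes_risk M w l T P"
      by (intro ereal_minus_mono order_refl)
    moreover have "t s \<le> (\<integral>x. (?R (\<eta> x) (f x) - ?R (\<eta> x) (\<eta> x)) \<partial>D)"
    proof -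
      \<comment> \<open>\<open>D\<close> has total mass one, so the constant \<open>s / 2\<close>
        integrates to itself.\<close>
      have "t s = (\<integral>x. \<psi> (s / 2) * (?C f x - ?C \<eta> x - s / 2) \<partial>D)"
        using zo_int f \<eta> by (simp add: t_def s_def D.prob_space field_simps)
      also have "\<dots> \<le> (\<integral>x. (?R (\<eta> x) (f x) - ?R (\<eta> x) (\<eta> x)) \<partial>D)"
      proof (rule integral_mono)
        fix x assume x: "x \<in> space D"
        show "\<psi> (s / 2) * (?C f x - ?C \<eta> x - s / 2) \<le> ?R (\<eta> x) (f x) - ?R (\<eta> x) (\<eta> x)"
          \<comment> \<open>In the difference of conditional 0-1 risks the constant one cancels,
            leaving the difference of posterior coordinates that occurs in
            \<open>bound\<close>.\<close>
          using bound[OF _ simplex[OF \<eta> x] simplex[OF f x], of "s / 2"] s_nonneg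
          by (simp add: cond_risk_zero_one simplex[OF \<eta> x])
      qed (use zo_int multi_int f \<eta> in auto)
      finally show ?thesis .
    qed
    ultimately show ?thesis
      using multi_int f \<eta> by (simp add: regret \<theta>_def multi_risk order_trans[rotated])
  qed
  ultimately show ?thesis by blast
qed

end
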